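(* Let $\ell,m\in\mathbb N$ with $1\le\ell\le m$, $\alpha\in\mathbb R$, and $\rho,\tau\in(0,\infty)$. With $A$, $B$, $c_{2j}$, $L_p$ as in the context: (a) If $\rho\ge\tau$, then for all $f\in C_0^\infty((\rho,\infty))$, \begin{align*} \int_\rho^\infty x^\alpha |f^{(m)}(x)|^2dx \ge{}& A(\ell,\alpha)\int_\rho^\infty x^{\alpha-2\ell}|f^{(m-\ell)}(x)|^2dx\\ &+B(\ell,\alpha)\sum_{k=1}^{\infty}\int_\rho^\infty x^{\alpha-2\ell}\prod_{p=1}^k[L_p(\tau/x)]^{2}|f^{(m-\ell)}(x)|^2dx\\ &+\sum_{j=2}^{\ell}|c_{2j}(\ell,\alpha)|A(j,0)\int_\rho^\infty x^{\alpha-2\ell}[L_1(\tau/x)]^{2j}|f^{(m-\ell)}(x)|^2dx\\ &+\sum_{j=2}^{\ell}|c_{2j}(\ell,\alpha)|B(j,0)\sum_{k=1}^{\infty}\int_\rho^\infty x^{\alpha-2\ell}[L_1(\tau/x)]^{2j}\prod_{p=1}^k[L_{p+1}(\tau/x)]^{2}|f^{(m-\ell)}(x)|^2dx. \end{align*} (b) If $\tau\ge\rho$, then for all $f\in C_0^\infty((0,\rho))$, \begin{align*} \int_0^\rho x^\alpha |f^{(m)}(x)|^2dx \ge{}& A(\ell,\alpha)\int_0^\rho x^{\alpha-2\ell}|f^{(m-\ell)}(x)|^2dx\\ &+B(\ell,\alpha)\sum_{k=1}^{\infty}\int_0^\rho x^{\alpha-2\ell}\prod_{p=1}^k[L_p(x/\tau)]^{2}|f^{(m-\ell)}(x)|^2dx\\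 &+\sum_{j=2}^{\ell}|c_{2j}(\ell,\alpha)|A(j,0)\int_0^\rho x^{\alpha-2\ell}[L_1(x/\tau)]^{2j}|f^{(m-\ell)}(x)|^2dx\\ &+\sum_{j=2}^{\ell}|c_{2j}(\ell,\alpha)|B(j,0)\sum_{k=1}^{\infty}\int_0^\rho x^{\alpha-2\ell}[L_1(x/\tau)]^{2j}\prod_{p=1}^k[L_{p+1}(x/\tau)]^{2}|f^{(m-\ell)}(x)|^2dx. \end{align*}
   Context: $\mathbb N=\{1,2,\dots\}$; functions are complex-valued; $C_0^\infty((a,b))$ denotes the smooth functions with compact support in the open interval $(a,b)$. The empty sum $\sum_{j=2}^{1}$ is $0$. Normalized iterated logarithms: $L_1(s)=(1-\ln s)^{-1}$ and $L_{j+1}(s)=L_1(L_j(s))$, $j\in\mathbb N$, for $s\in(0,1]$. Constants: for $m\in\mathbb N$, $\alpha\in\mathbb R$, $$A(m,\alpha)=\prod_{j=1}^m\Big(\frac{2j-1-\alpha}{2}\Big)^2,\qquad B(m,\alpha)=\frac1{4^m}\sum_{k=1}^m\prod_{\substack{j=1\\ j\ne k}}^m(2j-1-\alpha)^2,$$ and $c_i(m,\alpha)$, $0\le i\le 2m$, are the coefficients of the polynomial $$\sum_{i=0}^{2m}c_i(m,\alpha)\lambda^i=\prod_{j=1}^m\Big(\lambda^2-\frac{(2j-1-\alpha)^2}{4}\Big).$$ *)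

theory Defs
  imports "HOL-Analysis.Analysis" "HOL-Computational_Algebra.Polynomial"
begin

definition nth_deriv :: "nat \<Rightarrow> (real \<Rightarrow> complex) \<Rightarrow> real \<Rightarrow> complex" where
  "nth_deriv k f = ((\<lambda>g x. vector_derivative g (at x)) ^^ k) f"

(* Elements of C_0^\<infinity>(S), S open, are represented by their extensions by zero to the
   whole real line; these are exactly the smooth functions on the line whose support
   (closure taken in the line) is a compact subset of S. *)
definition test_functions :: "real set \<Rightarrow> (real \<Rightarrow> complex) set" where
  "test_functions S =
     {f. (\<forall>k x. nth_deriv k f differentiable (at x)) \<and>
         compact (closure {x. f x \<noteq> 0}) \<and> closure {x. f x \<noteq> 0} \<subseteq> S}"

(* Only j \<ge> 1 and arguments in (0,1] are meaningful. *)
definition norm_log :: "nat \<Rightarrow> real \<Rightarrow> real" where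
  "norm_log j = ((\<lambda>s. inverse (1 - ln s)) ^^ j)"

lemma norm_log_1: "norm_log 1 s = inverse (1 - ln s)"
  by (simp add: norm_log_def)

lemma norm_log_Suc: "norm_log (Suc j) s = norm_log 1 (norm_log j s)"
  by (simp add: norm_log_def)

definition A_const :: "nat \<Rightarrow> real \<Rightarrow> real" where
  "A_const m \<alpha> = (\<Prod>j=1..m. ((2 * real j - 1 - \<alpha>) / 2)\<^sup>2)"

definition B_const :: "nat \<Rightarrow> real \<Rightarrow> real" where
  "B_const m \<alpha> = 1 / 4 ^ m * (\<Sum>k=1..m. \<Prod>j\<in>{1..m} - {k}. (2 * real j - 1 - \<alpha>)\<^sup>2)"

definition c_coeff :: "nat \<Rightarrow> nat \<Rightarrow> real \<Rightarrow> real" where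
  "c_coeff i m \<alpha> = coeff (\<Prod>j=1..m. monom 1 2 - [:(2 * real j - 1 - \<alpha>)\<^sup>2 / 4:]) i"

end

theory Submission
  imports Defs
begin

text \<open>
  Put $g = f^{(m-\ell)}$, $s = (2\ell-1-\alpha)/2$ and $g(x) = x^{s} w(x)$. With $D = x\,d/dx$ one has
  $x^{\ell - s} g^{(\ell)} = \prod_j (D + a_j) w$, $a_j = (2j-1-\alpha)/2$, and since
  $\int |(D + a) u|^2 dx/x = \int (|D u|^2 + a^2 |u|^2) dx/x$, the left-hand side equals
  $\sum_i |c_{2i}(\ell,\alpha)| \int |D^i w|^2 dx/x$. The term $i = 0$ gives $A(\ell,\alpha)$.
  For $i = 1$, where the coefficient is $4 B(\ell,\alpha)$, one completes the square with
  $\phi = \frac12 \sum_k \prod_{p \le k} L_p$. For $i = j \ge 2$ the first two terms of the inequality are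
  applied once more, with $\alpha = 0$ and $\ell = j$, in the variable $1/L_1 = 1 \pm \ln(x/\tau)$.
  Both uses are covered by allowing a general variable $Y$ and measure $r\,dx$, where $|Y'| = r$, so that no
  integral is ever substituted.
\<close>

text \<open>
  The function \<open>w (Suc i)\<close> is the derivative of \<open>w i\<close> with respect to a variable \<open>t\<close> with \<open>dt = r dx\<close>.
  A factor of modulus one in this derivative is harmless: only the moduli of the \<open>w i\<close> matter.
\<close>
definition weighted_chain where
  "weighted_chain a b r l w \<longleftrightarrow>
     (\<forall>i<l. \<forall>x\<in>{a..b}. (w i has_vector_derivative r x *\<^sub>R w (Suc i) x) (at x within {a..b})) \<and>
     (\<forall>i\<le>l. continuous_on {a..b} (w i) \<and> w i a = 0 \<and> w i b = 0)"
  for a b :: real and r :: "real \<Rightarrow> real" and l :: nat and w :: "nat \<Rightarrow> real \<Rightarrow> complex"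

section \<open>Normalized iterated logarithms and their derivatives\<close>

lemma norm_log_Suc_inverse: "norm_log (Suc p) z = inverse (1 - ln (norm_log p z))"
  by (simp add: norm_log_def)

lemma norm_log_in_unit:
  assumes "0 < z" "z \<le> 1"
  shows "0 < norm_log p z \<and> norm_log p z \<le> 1"
proof (induction p)
  case 0
  then show ?case using assms by (simp add: norm_log_def)
next
  case (Suc p)
  then have "1 \<le> 1 - ln (norm_log p z)" by simp
  then show ?case
    unfolding norm_log_Suc_inverse using le_imp_inverse_le[of 1 "1 - ln (norm_log p z)"] by simp
qed

text \<open>Needed at the second level, where L_1(z) takes the place of z and every index moves up
  by one.\<close>

lemma norm_log_comp: "norm_log p (norm_log 1 z) = norm_log (p + 1) z"
  by (induction p) (simp_all add: norm_log_Suc_inverse norm_log_def)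

text \<open>If P_p denotes the product of L_1, ..., L_p, then ln L_p has derivative -\<epsilon> r
  P_p, so L_{p+1} = 1/(1 - ln L_p) has derivative -\<epsilon> r P_p L_{p+1}^2, and one factor
  L_{p+1} completes P_{p+1}. The start p = 0 is the hypothesis itself, as \<open>norm_log 0\<close>
  is the identity. With r = 1/x, the sign \<epsilon> = 1 fits z = \<tau>/x and \<epsilon> = -1 fits
  z = x/\<tau>.\<close>

lemma has_real_derivative_norm_log:
  assumes z: "(z has_real_derivative - \<epsilon> * r * z x) (at x within T)" and "0 < z x" "z x \<le> 1"
  shows "((\<lambda>x. norm_log p (z x)) has_real_derivative
           - \<epsilon> * r * norm_log p (z x) * (\<Prod>q=1..p. norm_log q (z x))) (at x within T)"
proof (induction p)
  case 0
  then show ?case using z by (simp add: norm_log_def)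
next
  case (Suc p)
  let ?L = "norm_log p (z x)" and ?P = "\<Prod>q=1..p. norm_log q (z x)"
  have L: "0 < ?L" "?L \<le> 1" using norm_log_in_unit assms by blast+
  then have "ln ?L \<le> 0" by simp
  then have nz: "1 - ln ?L \<noteq> 0" by simp
  have "((\<lambda>x. ln (norm_log p (z x))) has_real_derivative 1 / ?L * (- \<epsilon> * r * ?L * ?P))
      (at x within T)"
    by (rule DERIV_chain2[where f = ln and g = "\<lambda>x. norm_log p (z x)", OF DERIV_ln_divide[OF L(1)] Suc])
  then have "((\<lambda>x. ln (norm_log p (z x))) has_real_derivative - \<epsilon> * r * ?P) (at x within T)"
    using L by (simp add: mult_ac)
  from DERIV_inverse_fun[OF DERIV_diff[OF DERIV_const[of 1] this] nz]
  have "((\<lambda>x. inverse (1 - ln (norm_log p (z x)))) has_real_derivative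
      - (inverse (1 - ln ?L) * (\<epsilon> * r * ?P) * inverse (1 - ln ?L))) (at x within T)"
    by (simp add: mult_ac)
  then show ?case
    using L by (simp add: norm_log_Suc_inverse mult_ac)
qed

text \<open>Logarithmic derivatives add up: the factor L_n contributes -\<epsilon> r L_1 ...
  L_n.\<close>

lemma has_real_derivative_prod_norm_log:
  assumes z: "(z has_real_derivative - \<epsilon> * r * z x) (at x within T)" and "0 < z x" "z x \<le> 1"
  shows "((\<lambda>x. \<Prod>p=1..k. norm_log p (z x)) has_real_derivative
           - \<epsilon> * r * (\<Prod>p=1..k. norm_log p (z x)) * (\<Sum>n=1..k. \<Prod>p=1..n. norm_log p (z x)))
         (at x within T)"
proof (induction k)
  case (Suc k)
  show ?case
    using DERIV_mult[OF Suc has_real_derivative_norm_log[OF assms, of "Suc k"]]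
    by (simp add: algebra_simps)
qed simp

section \<open>Energy identities and the logarithmic Hardy inequality with finitely many
  terms\<close>

text \<open>The inner sums include n = k, so doubling gives the full square plus one extra copy of
  the diagonal. This is what makes \<phi> below solve a Riccati equation.\<close>

lemma sum_mult_partial_sums:
  fixes f :: "nat \<Rightarrow> real"
  shows "2 * (\<Sum>k=1..N. f k * (\<Sum>n=1..k. f n)) = (\<Sum>k=1..N. f k)\<^sup>2 + (\<Sum>k=1..N. (f k)\<^sup>2)"
  by (induction N) (simp_all add: algebra_simps power2_eq_square)

lemma has_real_derivative_cmod_square:
  fixes u :: "real \<Rightarrow> complex"
  assumes "(u has_vector_derivative r *\<^sub>R v) (at x within T)"
  shows "((\<lambda>x. (cmod (u x))\<^sup>2) has_real_derivative 2 * r * Re (v * cnj (u x))) (at x within T)"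
proof -
  have re: "((\<lambda>x. Re (u x)) has_real_derivative r * Re v) (at x within T)"
    using has_derivative_Re[OF assms[unfolded has_vector_derivative_def]]
    by (simp add: has_field_derivative_def mult_commute_abs mult_ac)
  have im: "((\<lambda>x. Im (u x)) has_real_derivative r * Im v) (at x within T)"
    using has_derivative_Im[OF assms[unfolded has_vector_derivative_def]]
    by (simp add: has_field_derivative_def mult_commute_abs mult_ac)
  show ?thesis
    unfolding cmod_power2
    by (rule derivative_eq_intros re im refl)+ (simp add: algebra_simps)
qed

lemma integral_derivative_zero:
  fixes F F' :: "real \<Rightarrow> real"
  assumes "a \<le> b" "\<And>x. x \<in> {a..b} \<Longrightarrow> (F has_real_derivative F' x) (at x within {a..b})"
    and "F a = 0" "F b = 0"
  shows "(F' has_integral 0) {a..b}"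
  using fundamental_theorem_of_calculus[of a b F F'] assms
  by (auto simp: has_real_derivative_iff_has_vector_derivative)

lemma integrable_energy:
  fixes g :: "real \<Rightarrow> complex"
  assumes "continuous_on {a..b} h" "continuous_on {a..b} g"
  shows "(\<lambda>x. h x * (cmod (g x))\<^sup>2) integrable_on {a..b}"
  using assms by (intro integrable_continuous_interval continuous_intros)

lemma cmod_add_scaleR_square:
  "(cmod (v + t *\<^sub>R u))\<^sup>2 = (cmod v)\<^sup>2 + t * (2 * Re (v * cnj u)) + t\<^sup>2 * (cmod u)\<^sup>2"
  unfolding cmod_power2 by (simp add: power2_eq_square algebra_simps)

text \<open>Expanding the square, the cross term is \<open>t\<close> times the integrand of the last
  hypothesis. In the application that integrand is the derivative of |u|^2 for a \<open>u\<close>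
  vanishing at both ends.\<close>

lemma energy_shift:
  fixes u v :: "real \<Rightarrow> complex"
  assumes "continuous_on {a..b} r" "continuous_on {a..b} u" "continuous_on {a..b} v"
    and "((\<lambda>x. 2 * r x * Re (v x * cnj (u x))) has_integral 0) {a..b}"
  shows "integral {a..b} (\<lambda>x. r x * (cmod (v x + t *\<^sub>R u x))\<^sup>2) =
         integral {a..b} (\<lambda>x. r x * (cmod (v x))\<^sup>2) + t\<^sup>2 * integral {a..b} (\<lambda>x. r x * (cmod (u x))\<^sup>2)"
proof -
  have u: "(\<lambda>x. r x * (cmod (u x))\<^sup>2) integrable_on {a..b}"
    and v: "(\<lambda>x. r x * (cmod (v x))\<^sup>2) integrable_on {a..b}"
    using assms by (auto intro: integrable_energy)
  have "((\<lambda>x. r x * (cmod (v x))\<^sup>2 + (t * (2 * r x * Re (v x * cnj (u x))) + t\<^sup>2 * (r x * (cmod (u x))\<^sup>2)))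
     has_integral (integral {a..b} (\<lambda>x. r x * (cmod (v x))\<^sup>2) + (t * 0 +
       t\<^sup>2 * integral {a..b} (\<lambda>x. r x * (cmod (u x))\<^sup>2)))) {a..b}"
    by (intro has_integral_add has_integral_mult_right assms integrable_integral u v)
  then show ?thesis
    by (intro integral_unique) (simp add: cmod_add_scaleR_square algebra_simps)
qed

text \<open>The function \<phi>, half the sum of the products Q_1, ..., Q_N, solves \<epsilon>
  \<phi>' = -r (\<phi>^2 + (Q_1^2 + ... + Q_N^2)/4). Adding the derivative of \<epsilon> \<phi>
  |w_0|^2, whose integral is 0, to r |w_1 - \<epsilon> \<phi> w_0|^2 cancels the cross term and the
  \<phi>^2 term. The bound does not depend on N, which later admits the infinite series.\<close>

lemma log_hardy_finite:
  assumes ab: "a \<le> b" and w: "weighted_chain a b r l w" and l: "1 \<le> l"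
    and r: "continuous_on {a..b} r" "\<And>x. x \<in> {a..b} \<Longrightarrow> 0 < r x"
    and \<epsilon>: "\<epsilon>\<^sup>2 = (1::real)"
    and z: "\<And>x. x \<in> {a..b} \<Longrightarrow> 0 < z x \<and> z x \<le> 1"
      "\<And>x. x \<in> {a..b} \<Longrightarrow> (z has_real_derivative - \<epsilon> * r x * z x) (at x within {a..b})"
  shows "(\<Sum>k=1..N. integral {a..b} (\<lambda>x. r x * (\<Prod>p=1..k. (norm_log p (z x))\<^sup>2) * (cmod (w 0 x))\<^sup>2))
         \<le> 4 * integral {a..b} (\<lambda>x. r x * (cmod (w 1 x))\<^sup>2)"
proof -
  define Q where "Q k x = (\<Prod>p=1..k. norm_log p (z x))" for k x
  define \<phi> where "\<phi> x = (\<Sum>k=1..N. Q k x) / 2" for x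
  define D where "D x = - \<epsilon> * r x * (\<Sum>k=1..N. Q k x * (\<Sum>n=1..k. Q n x)) / 2" for x
  define F' where "F' x = D x * (cmod (w 0 x))\<^sup>2 + 2 * r x * Re (w 1 x * cnj (w 0 x)) * \<phi> x" for x
  have Q: "(Q k has_real_derivative - \<epsilon> * r x * Q k x * (\<Sum>n=1..k. Q n x)) (at x within {a..b})"
    if "x \<in> {a..b}" for k x
    unfolding Q_def using z that by (intro has_real_derivative_prod_norm_log) auto
  then have Qc: "continuous_on {a..b} (Q k)" for k
    by (rule DERIV_continuous_on)
  have \<phi>: "(\<phi> has_real_derivative D x) (at x within {a..b})" if "x \<in> {a..b}" for x
  proof -
    have "((\<lambda>x. \<Sum>k=1..N. Q k x) has_real_derivative
        (\<Sum>k=1..N. - \<epsilon> * r x * Q k x * (\<Sum>n=1..k. Q n x))) (at x within {a..b})"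
      by (intro DERIV_sum Q that)
    from DERIV_cdivide[OF this, of 2] show ?thesis
      by (simp add: \<phi>_def[abs_def] D_def sum_distrib_left mult_ac)
  qed
  have w0: "continuous_on {a..b} (w 0)" "continuous_on {a..b} (w 1)" "w 0 a = 0" "w 0 b = 0"
    using w l unfolding weighted_chain_def by auto
  have wd: "((\<lambda>x. (cmod (w 0 x))\<^sup>2) has_real_derivative 2 * r x * Re (w 1 x * cnj (w 0 x))) (at x within {a..b})"
    if "x \<in> {a..b}" for x
    using w l that unfolding weighted_chain_def
    by (intro has_real_derivative_cmod_square) auto
  have "(F' has_integral 0) {a..b}"
  proof (rule integral_derivative_zero[OF ab])
    show "((\<lambda>x. \<phi> x * (cmod (w 0 x))\<^sup>2) has_real_derivative F' x) (at x within {a..b})"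
      if "x \<in> {a..b}" for x
      unfolding F'_def using DERIV_mult[OF \<phi> wd] that by blast
  qed (simp_all add: w0)
  \<comment> \<open>As \<epsilon>^2 = 1, this factor removes the sign in \<open>D\<close> and makes
    the mixed term of \<open>F'\<close> opposite to the one in the square.\<close>
  from has_integral_mult_right[OF this, of \<epsilon>]
  have zero: "((\<lambda>x. \<epsilon> * F' x) has_integral 0) {a..b}" by simp
  have int: "(\<lambda>x. r x * (Q k x)\<^sup>2 * (cmod (w 0 x))\<^sup>2) integrable_on {a..b}" for k
    by (intro integrable_energy continuous_intros r Qc w0)
  have pw: "(\<Sum>k=1..N. r x * (Q k x)\<^sup>2 * (cmod (w 0 x))\<^sup>2) + 4 * (\<epsilon> * F' x) \<le> 4 * (r x * (cmod (w 1 x))\<^sup>2)"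
    if x: "x \<in> {a..b}" for x
  proof -
    \<comment> \<open>Completing the square with the logarithmic derivative \<open>\<phi>\<close> of the
      ground state of the finite Hardy inequality.\<close>
    have "0 \<le> r x * (cmod (w 1 x + (- \<epsilon> * \<phi> x) *\<^sub>R w 0 x))\<^sup>2" using r x by (simp add: less_imp_le)
    also have "\<dots> = r x * (cmod (w 1 x))\<^sup>2 - \<epsilon> * \<phi> x * (2 * r x * Re (w 1 x * cnj (w 0 x)))
         + r x * (\<phi> x)\<^sup>2 * (cmod (w 0 x))\<^sup>2"
      unfolding cmod_add_scaleR_square using \<epsilon> by (simp add: algebra_simps power_mult_distrib)
    finally have 1: "0 \<le> \<dots>" .
    have "\<epsilon> * D x = - (\<epsilon>\<^sup>2) * r x * (\<Sum>k=1..N. Q k x * (\<Sum>n=1..k. Q n x)) / 2"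
      by (simp add: D_def power2_eq_square)
    also have "\<dots> = - r x * (2 * (\<Sum>k=1..N. Q k x * (\<Sum>n=1..k. Q n x))) / 4"
      using \<epsilon> by simp
    also have "\<dots> = - r x * (\<phi> x)\<^sup>2 - r x * (\<Sum>k=1..N. (Q k x)\<^sup>2) / 4"
      unfolding sum_mult_partial_sums \<phi>_def by (simp add: field_simps)
    finally have 2: "\<epsilon> * D x = \<dots>" .
    have 3: "\<epsilon> * F' x = (- r x * (\<phi> x)\<^sup>2 - r x * (\<Sum>k=1..N. (Q k x)\<^sup>2) / 4) * (cmod (w 0 x))\<^sup>2
        + \<epsilon> * \<phi> x * (2 * r x * Re (w 1 x * cnj (w 0 x)))"
      unfolding 2[symmetric] F'_def by (simp add: algebra_simps)
    have "(\<Sum>k=1..N. r x * (Q k x)\<^sup>2 * (cmod (w 0 x))\<^sup>2) = r x * (\<Sum>k=1..N. (Q k x)\<^sup>2) * (cmod (w 0 x))\<^sup>2"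
      by (simp add: sum_distrib_left sum_distrib_right)
    then show ?thesis using 1 unfolding 3 by (simp add: algebra_simps)
  qed
  have "((\<lambda>x. (\<Sum>k=1..N. r x * (Q k x)\<^sup>2 * (cmod (w 0 x))\<^sup>2) + 4 * (\<epsilon> * F' x)) has_integral
      (\<Sum>k=1..N. integral {a..b} (\<lambda>x. r x * (Q k x)\<^sup>2 * (cmod (w 0 x))\<^sup>2)) + 4 * 0) {a..b}"
    by (intro has_integral_add has_integral_mult_right has_integral_sum zero integrable_integral int) simp
  moreover have "((\<lambda>x. 4 * (r x * (cmod (w 1 x))\<^sup>2)) has_integral
      4 * integral {a..b} (\<lambda>x. r x * (cmod (w 1 x))\<^sup>2)) {a..b}"
    by (intro has_integral_mult_right integrable_integral integrable_energy r w0)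
  ultimately have "(\<Sum>k=1..N. integral {a..b} (\<lambda>x. r x * (Q k x)\<^sup>2 * (cmod (w 0 x))\<^sup>2)) + 4 * 0 \<le>
      4 * integral {a..b} (\<lambda>x. r x * (cmod (w 1 x))\<^sup>2)"
    by (rule has_integral_le) (rule pw)
  then show ?thesis by (simp add: Q_def prod_power_distrib)
qed

section \<open>The polynomial of the energy coefficients and its relation to A, B and c\<close>

text \<open>Up to the sign (-1)^l this is the polynomial behind \<open>c_coeff\<close> with
  \<lambda>^2 replaced by -X. Its coefficients are nonnegative and hence equal the moduli of the
  even-indexed c.\<close>

definition energy_poly :: "nat \<Rightarrow> real \<Rightarrow> real poly" where
  "energy_poly l \<alpha> = (\<Prod>j=1..l. [:((2 * real j - 1 - \<alpha>) / 2)\<^sup>2, 1:])"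

lemma coeff_mult_linear:
  "coeff ([:c, 1:] * q) i = c * coeff q i + (case i of 0 \<Rightarrow> 0 | Suc n \<Rightarrow> coeff q n)"
  for c :: "'a :: comm_ring_1"
  by (simp add: coeff_pCons split: nat.split)

text \<open>Read the sum as the linear functional sending X^n to \<open>F n\<close>: multiplication
  by c + X becomes c times the value plus the value for the shifted sequence. The degree bound kills
  the top term of the first part.\<close>

lemma sum_coeff_mult_linear:
  fixes F :: "nat \<Rightarrow> 'a :: comm_ring_1"
  assumes "degree q \<le> i"
  shows "(\<Sum>n\<le>Suc i. coeff ([:c, 1:] * q) n * F n) =
         c * (\<Sum>n\<le>i. coeff q n * F n) + (\<Sum>n\<le>i. coeff q n * F (Suc n))"
proof -
  have "(\<Sum>n\<le>Suc i. coeff ([:c, 1:] * q) n * F n) =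
        (\<Sum>n\<le>Suc i. c * (coeff q n * F n)) +
        (\<Sum>n\<le>Suc i. (case n of 0 \<Rightarrow> 0 | Suc k \<Rightarrow> coeff q k) * F n)"
    unfolding coeff_mult_linear by (simp only: distrib_right mult.assoc sum.distrib)
  moreover have "(\<Sum>n\<le>Suc i. c * (coeff q n * F n)) = c * (\<Sum>n\<le>i. coeff q n * F n)"
    using assms by (simp add: sum_distrib_left coeff_eq_0)
  moreover have "(\<Sum>n\<le>Suc i. (case n of 0 \<Rightarrow> 0 | Suc k \<Rightarrow> coeff q k) * F n) = (\<Sum>n\<le>i. coeff q n * F (Suc n))"
    by (subst sum.atMost_Suc_shift) simp
  ultimately show ?thesis by simp
qed

lemma degree_prod_linear_le: "degree (\<Prod>j<i. [:c j, 1::'a::comm_ring_1:]) \<le> i"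
proof (induction i)
  case (Suc i)
  have "degree ((\<Prod>j<i. [:c j, 1:]) * [:c i, 1:]) \<le> degree (\<Prod>j<i. [:c j, 1:]) + degree [:c i, 1:]"
    by (rule degree_mult_le)
  also have "\<dots> \<le> i + 1" using Suc by (intro add_mono) auto
  finally show ?case by simp
qed simp

text \<open>The energy recursion yields the factors in reverse order and with c_j known only up to
  sign.\<close>

lemma energy_poly_reindex:
  assumes "\<And>j. j < l \<Longrightarrow> (c j)\<^sup>2 = ((2 * real (l - j) - 1 - \<alpha>) / 2)\<^sup>2"
  shows "(\<Prod>j<l. [:(c j)\<^sup>2, 1:]) = energy_poly l \<alpha>"
proof -
  have "energy_poly l \<alpha> = (\<Prod>k<l. [:((2 * real (Suc k) - 1 - \<alpha>) / 2)\<^sup>2, 1:])"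
    unfolding energy_poly_def One_nat_def prod.atLeast1_atMost_eq ..
  also have "\<dots> = (\<Prod>j<l. [:((2 * real (Suc (l - Suc j)) - 1 - \<alpha>) / 2)\<^sup>2, 1:])"
    by (rule prod.nat_diff_reindex[symmetric])
  also have "\<dots> = (\<Prod>j<l. [:(c j)\<^sup>2, 1:])"
    using assms by (intro prod.cong) (auto simp: Suc_diff_Suc)
  finally show ?thesis by simp
qed

lemma coeff_prod_linear_nonneg:
  assumes "finite S" "\<And>j. j \<in> S \<Longrightarrow> (0::real) \<le> b j"
  shows "0 \<le> coeff (\<Prod>j\<in>S. [:b j, 1:]) i"
  using assms
proof (induction S arbitrary: i rule: finite_induct)
  case (insert x S)
  then show ?case
    unfolding prod.insert[OF insert.hyps] coeff_mult_linear by (auto split: nat.split)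
qed (simp add: coeff_pCons split: nat.split)

text \<open>Putting \<lambda>^2 = -X turns each factor \<lambda>^2 - b into -(X + b): one sign per
  factor and one per power of X.\<close>

lemma coeff_prod_square_minus:
  fixes b :: "'b \<Rightarrow> real"
  assumes "finite S"
  shows "coeff (\<Prod>j\<in>S. monom 1 2 - [:b j:]) (2 * i) =
         (-1) ^ (card S + i) * coeff (\<Prod>j\<in>S. [:b j, 1:]) i"
  using assms
proof (induction S arbitrary: i rule: finite_induct)
  case empty
  then show ?case by (cases i) (simp_all add: coeff_pCons split: nat.split)
next
  case (insert x S)
  show ?case
    unfolding prod.insert[OF insert.hyps] coeff_mult_linear
    using insert.hyps insert.IH[of i] insert.IH[of "i - 1"]
    by (cases i) (simp_all add: left_diff_distrib coeff_monom_mult algebra_simps)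
qed

lemma energy_poly_nonneg: "0 \<le> coeff (energy_poly l \<alpha>) i"
  unfolding energy_poly_def by (rule coeff_prod_linear_nonneg) auto

lemma abs_c_coeff: "\<bar>c_coeff (2 * i) l \<alpha>\<bar> = coeff (energy_poly l \<alpha>) i"
proof -
  have "c_coeff (2 * i) l \<alpha> = (-1) ^ (card {1..l} + i) * coeff (energy_poly l \<alpha>) i"
    unfolding c_coeff_def energy_poly_def
    by (subst coeff_prod_square_minus[symmetric]) (simp_all add: power_divide)
  then show ?thesis
    using energy_poly_nonneg by (simp add: abs_mult power_abs)
qed

lemma energy_poly_coeff_0: "coeff (energy_poly l \<alpha>) 0 = A_const l \<alpha>"
  by (simp add: energy_poly_def A_const_def poly_prod flip: poly_0_coeff_0)

text \<open>The linear coefficient is the derivative at 0, where the product rule omits one factor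
  at a time. Only l - 1 factors 1/4 remain, against 4^l in B, whence the 4.\<close>

lemma energy_poly_coeff_1:
  assumes "1 \<le> l"
  shows "coeff (energy_poly l \<alpha>) 1 = 4 * B_const l \<alpha>"
proof -
  let ?h = "\<lambda>j. 2 * real j - 1 - \<alpha>"
  have "coeff (energy_poly l \<alpha>) 1 = poly (pderiv (energy_poly l \<alpha>)) 0"
    by (simp add: poly_0_coeff_0 coeff_pderiv)
  also have "\<dots> = (\<Sum>k=1..l. \<Prod>j\<in>{1..l}-{k}. (?h j)\<^sup>2 / 4)"
    by (simp add: energy_poly_def pderiv_prod poly_sum poly_prod pderiv_pCons power_divide)
  also have "\<dots> = (\<Sum>k=1..l. (\<Prod>j\<in>{1..l}-{k}. (?h j)\<^sup>2) / 4 ^ (l - 1))"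
    by (intro sum.cong) (simp_all add: prod_dividef)
  also have "\<dots> = 4 * B_const l \<alpha>"
    using assms by (cases l) (simp_all add: B_const_def sum_divide_distrib[symmetric] field_simps)
  finally show ?thesis .
qed

section \<open>Infinite sums, the Emden transformation and one level of the inequality\<close>

lemma nonneg_bounded_partial_sums_infsum:
  fixes T :: "nat \<Rightarrow> real"
  assumes nn: "\<And>k. 0 \<le> T k" and C: "\<And>N. (\<Sum>k=1..N. T k) \<le> C"
  shows "T summable_on {1..}" "infsum T {1..} \<le> C"
proof -
  have F: "sum T F \<le> C" if "finite F" "F \<subseteq> {1..}" for F
  proof -
    have "sum T F \<le> (\<Sum>k=1..Max F. T k)"
      using that nn by (intro sum_mono2) auto
    then show ?thesis using C order_trans by blast
  qed
  show "T summable_on {1..}"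
    using F nn by (intro nonneg_bdd_above_summable_on) (auto intro!: bdd_aboveI[of _ C])
  then show "infsum T {1..} \<le> C"
    by (rule infsum_le_finite_sums) (use F in auto)
qed

lemma powr_square_cmod:
  fixes u :: complex
  assumes "0 < y"
  shows "(cmod ((y powr e) *\<^sub>R u))\<^sup>2 / y = y powr (2 * e - 1) * (cmod u)\<^sup>2"
  using assms by (simp add: power_mult_distrib powr_diff powr_power)

text \<open>In the variable t with dt = (r/Y) dx and D = d/dt, the functions v_i = Y^(i-s) g_i
  satisfy v_{i+1} = (D + c_i) v_i. Thus v_l arises from w_0 = v_0 by l first-order factors, and each
  factor adds c_i^2 times the lower energy.\<close>

lemma emden_energy:
  assumes ab: "a \<le> b" and g: "weighted_chain a b r l g" and rc: "continuous_on {a..b} r"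
    and Y: "\<And>x. x \<in> {a..b} \<Longrightarrow> 0 < Y x"
      "\<And>x. x \<in> {a..b} \<Longrightarrow> (Y has_real_derivative \<eta> * r x) (at x within {a..b})"
    and \<eta>: "\<eta>\<^sup>2 = (1::real)"
  obtains w where "weighted_chain a b (\<lambda>x. r x / Y x) l w"
    and "\<And>x. x \<in> {a..b} \<Longrightarrow>
      r x / Y x * (cmod (w 0 x))\<^sup>2 = r x * Y x powr (\<alpha> - 2 * real l) * (cmod (g 0 x))\<^sup>2"
    and "integral {a..b} (\<lambda>x. r x * Y x powr \<alpha> * (cmod (g l x))\<^sup>2) =
      (\<Sum>n\<le>l. coeff (energy_poly l \<alpha>) n * integral {a..b} (\<lambda>x. r x / Y x * (cmod (w n x))\<^sup>2))"
proof -
  \<comment> \<open>Chosen so that 2(i - s) - 1 is \<alpha> - 2l at i = 0 and \<alpha> at i = l; the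
    -1 comes from the 1/Y in the new measure.\<close>
  define s where "s = (2 * real l - 1 - \<alpha>) / 2"
  define c where "c i = \<eta> * (s - real i)" for i :: nat
  define v where "v i x = (Y x powr (real i - s)) *\<^sub>R g i x" for i x
  define R where "R x = r x / Y x" for x
  \<comment> \<open>\<open>d k i\<close> is the \<open>k\<close>-th derivative of \<open>v i\<close> in the new variable, so \<open>v (i + 1) = (D + c i) (v i)\<close>.\<close>
  define d where "d = rec_nat v (\<lambda>_ e i x. e (Suc i) x - c i *\<^sub>R e i x)"
  have d0: "d 0 = v" and dS: "d (Suc k) i x = d k (Suc i) x - c i *\<^sub>R d k i x" for k i x
    by (simp_all add: d_def)
  have dS_fun: "d (Suc k) i = (\<lambda>x. d k (Suc i) x - c i *\<^sub>R d k i x)" for k i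
    by (simp add: d_def)
  have Yc: "continuous_on {a..b} Y"
    using Y(2) by (rule DERIV_continuous_on)
  have Rc: "continuous_on {a..b} R"
    unfolding R_def using Y(1) by (intro continuous_intros rc Yc) force
  have gd: "(g i has_vector_derivative r x *\<^sub>R g (Suc i) x) (at x within {a..b})"
    if "i < l" "x \<in> {a..b}" for i x
    using g that unfolding weighted_chain_def by blast
  have g0: "continuous_on {a..b} (g i) \<and> g i a = 0 \<and> g i b = 0" if "i \<le> l" for i
    using g that unfolding weighted_chain_def by blast
  have vd: "(v i has_vector_derivative R x *\<^sub>R d 1 i x) (at x within {a..b})"
    if "i < l" "x \<in> {a..b}" for i x
  proof -
    let ?e = "real i - s"
    have "((\<lambda>x. Y x powr ?e) has_real_derivative ?e * Y x powr (?e - 1) * (\<eta> * r x)) (at x within {a..b})"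
      using DERIV_chain2[where f = "\<lambda>y. y powr ?e" and g = Y, OF has_real_derivative_powr Y(2)] Y(1) that
      by simp
    from has_vector_derivative_scaleR[OF this gd[OF that]]
    have "(v i has_vector_derivative (Y x powr ?e) *\<^sub>R (r x *\<^sub>R g (Suc i) x) +
        (?e * Y x powr (?e - 1) * (\<eta> * r x)) *\<^sub>R g i x) (at x within {a..b})"
      unfolding v_def[abs_def] .
    moreover have "(Y x powr ?e) *\<^sub>R (r x *\<^sub>R g (Suc i) x) +
        (?e * Y x powr (?e - 1) * (\<eta> * r x)) *\<^sub>R g i x = R x *\<^sub>R d 1 i x"
    proof -
      have "R x * Y x powr (real (Suc i) - s) = Y x powr ?e * r x"
        "?e * Y x powr (?e - 1) * (\<eta> * r x) = - (R x * (c i * Y x powr ?e))"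
        using Y(1)[OF that(2)]
        by (simp_all add: R_def c_def powr_diff powr_add field_simps)
      then show ?thesis
        by (simp add: dS d0 v_def scaleR_diff_right)
    qed
    ultimately show ?thesis by simp
  qed
  \<comment> \<open>D commutes with the constants \<open>c i\<close>, so the recursion for
    \<open>d\<close> passes through it. The bound on \<open>k + i\<close> is there because
    \<open>d k i\<close> involves \<open>g\<close> up to index \<open>k + i\<close> and is
    differentiated once more.\<close>
  have dd: "(d k i has_vector_derivative R x *\<^sub>R d (Suc k) i x) (at x within {a..b})"
    if "k + i < l" "x \<in> {a..b}" for k i x
    using that
  proof (induction k arbitrary: i)
    case 0
    then show ?case using vd by (simp add: d0)
  next
    case (Suc k)
    have "((\<lambda>x. d k (Suc i) x - c i *\<^sub>R d k i x) has_vector_derivative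
        R x *\<^sub>R d (Suc k) (Suc i) x - c i *\<^sub>R (R x *\<^sub>R d (Suc k) i x)) (at x within {a..b})"
      using Suc by (intro has_vector_derivative_diff Suc.IH
          bounded_linear.has_vector_derivative[OF bounded_linear_scaleR_right[of "c i"]]) auto
    then show ?case
      unfolding dS_fun[of k i] dS[of "Suc k" i x]
      by (simp add: scaleR_diff_right mult_ac)
  qed
  have d_bd: "continuous_on {a..b} (d k i) \<and> d k i a = 0 \<and> d k i b = 0" if "k + i \<le> l" for k i
    using that
  proof (induction k arbitrary: i)
    case 0
    have "continuous_on {a..b} (v i)"
      unfolding v_def using g0[of i] 0 Y(1) by (intro continuous_intros Yc) force+
    then show ?case using g0[of i] 0 by (simp add: d0 v_def)
  next
    case (Suc k)
    have "continuous_on {a..b} (\<lambda>x. d k (Suc i) x - c i *\<^sub>R d k i x)"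
      using Suc by (intro continuous_intros) auto
    then show ?case using Suc.IH[of i] Suc.IH[of "Suc i"] Suc.prems
      unfolding dS_fun[of k i] by simp
  qed
  define w where "w k = d k 0" for k
  define I where "I k i = integral {a..b} (\<lambda>x. R x * (cmod (d k i x))\<^sup>2)" for k i
  \<comment> \<open>By construction \<open>d k (Suc i)\<close> is \<open>d (Suc k) i\<close> plus
    \<open>c i\<close> times \<open>d k i\<close>, and \<open>d (Suc k) i\<close> is the derivative
    of \<open>d k i\<close>, so the cross term integrates to 0.\<close>
  have step: "I k (Suc i) = I (Suc k) i + (c i)\<^sup>2 * I k i" if "k + i < l" for k i
  proof -
    have "((\<lambda>x. 2 * R x * Re (d (Suc k) i x * cnj (d k i x))) has_integral 0) {a..b}"
      using dd d_bd that
      by (intro integral_derivative_zero[OF ab, of "\<lambda>x. (cmod (d k i x))\<^sup>2"]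
          has_real_derivative_cmod_square) auto
    from energy_shift[OF Rc _ _ this, of "c i"] that d_bd[of k i] d_bd[of "Suc k" i]
    show ?thesis by (simp add: I_def dS)
  qed
  \<comment> \<open>The induction on \<open>i\<close> runs over all \<open>k\<close> together, since
    the step uses both \<open>k\<close> and \<open>Suc k\<close>.\<close>
  have I: "I k i = (\<Sum>n\<le>i. coeff (\<Prod>j<i. [:(c j)\<^sup>2, 1:]) n * I (k + n) 0)" if "k + i \<le> l" for k i
    using that
  proof (induction i arbitrary: k)
    case (Suc i)
    let ?q = "\<Prod>j<i. [:(c j)\<^sup>2, 1:]"
    have "(\<Sum>n\<le>Suc i. coeff ([:(c i)\<^sup>2, 1:] * ?q) n * I (k + n) 0) = (c i)\<^sup>2 * I k i + I (Suc k) i"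
      using Suc.IH[of k] Suc.IH[of "Suc k"] Suc.prems
      by (subst sum_coeff_mult_linear) (auto intro: degree_prod_linear_le)
    moreover have "(\<Prod>j<Suc i. [:(c j)\<^sup>2, 1:]) = [:(c i)\<^sup>2, 1:] * ?q"
      by (simp only: prod.lessThan_Suc mult.commute)
    ultimately show ?case
      using step[of k i] Suc.prems by simp
  qed simp
  have q: "(\<Prod>j<l. [:(c j)\<^sup>2, 1:]) = energy_poly l \<alpha>"
  proof (rule energy_poly_reindex)
    fix j assume "j < l"
    then have sj: "s - real j = (2 * real (l - j) - 1 - \<alpha>) / 2"
      by (simp add: s_def field_simps)
    show "(c j)\<^sup>2 = ((2 * real (l - j) - 1 - \<alpha>) / 2)\<^sup>2"
      unfolding c_def power_mult_distrib \<eta> sj by simp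
  qed
  show ?thesis
  proof (rule that[of w])
    show "weighted_chain a b (\<lambda>x. r x / Y x) l w"
      using dd d_bd unfolding weighted_chain_def w_def R_def by auto
    show "r x / Y x * (cmod (w 0 x))\<^sup>2 = r x * Y x powr (\<alpha> - 2 * real l) * (cmod (g 0 x))\<^sup>2"
      if "x \<in> {a..b}" for x
    proof -
      have "2 * - s - 1 = \<alpha> - 2 * real l" by (simp add: s_def field_simps)
      then have "(cmod (w 0 x))\<^sup>2 / Y x = Y x powr (\<alpha> - 2 * real l) * (cmod (g 0 x))\<^sup>2"
        using powr_square_cmod[OF Y(1)[OF that], of "- s" "g 0 x"] by (simp add: w_def d0 v_def)
      then show ?thesis
        by (metis mult.assoc times_divide_eq_left times_divide_eq_right)
    qed
    have "integral {a..b} (\<lambda>x. r x * Y x powr \<alpha> * (cmod (g l x))\<^sup>2) = I 0 l"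
      unfolding I_def
    proof (rule integral_cong)
      fix x assume "x \<in> {a..b}"
      from powr_square_cmod[OF Y(1)[OF this], of "real l - s" "g l x"]
      have "(cmod (d 0 l x))\<^sup>2 / Y x = Y x powr (2 * (real l - s) - 1) * (cmod (g l x))\<^sup>2"
        by (simp add: d0 v_def)
      moreover have "2 * (real l - s) - 1 = \<alpha>" by (simp add: s_def field_simps)
      ultimately show "r x * Y x powr \<alpha> * (cmod (g l x))\<^sup>2 = R x * (cmod (d 0 l x))\<^sup>2"
        unfolding R_def by (metis mult.assoc times_divide_eq_left times_divide_eq_right)
    qed
    also have "\<dots> = (\<Sum>n\<le>l. coeff (energy_poly l \<alpha>) n * I n 0)"
      using I[of 0 l] by (simp add: q)
    finally show "integral {a..b} (\<lambda>x. r x * Y x powr \<alpha> * (cmod (g l x))\<^sup>2) =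
      (\<Sum>n\<le>l. coeff (energy_poly l \<alpha>) n * integral {a..b} (\<lambda>x. r x / Y x * (cmod (w n x))\<^sup>2))"
      by (simp add: I_def w_def R_def)
  qed
qed

text \<open>The energies of index j >= 2 are kept in terms of \<open>w\<close>, so that the lemma
  can be applied to them again. It is used with Y = x, r = 1, and then with Y = 1/L_1(z), r = 1/x
  and L_1(z) in the place of z.\<close>

lemma hardy_rellich_remainder:
  fixes \<alpha> :: real
  assumes ab: "a \<le> b" and g: "weighted_chain a b r l g" and l: "1 \<le> l"
    and r: "continuous_on {a..b} r" "\<And>x. x \<in> {a..b} \<Longrightarrow> 0 < r x"
    and Y: "\<And>x. x \<in> {a..b} \<Longrightarrow> 0 < Y x"
      "\<And>x. x \<in> {a..b} \<Longrightarrow> (Y has_real_derivative \<eta> * r x) (at x within {a..b})"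
    and \<eta>: "\<eta>\<^sup>2 = (1::real)" and \<epsilon>: "\<epsilon>\<^sup>2 = (1::real)"
    and z: "\<And>x. x \<in> {a..b} \<Longrightarrow> 0 < z x \<and> z x \<le> 1"
      "\<And>x. x \<in> {a..b} \<Longrightarrow> (z has_real_derivative - \<epsilon> * (r x / Y x) * z x) (at x within {a..b})"
  defines "T \<equiv> \<lambda>k. integral {a..b} (\<lambda>x. r x * Y x powr (\<alpha> - 2 * real l) *
      (\<Prod>p=1..k. (norm_log p (z x))\<^sup>2) * (cmod (g 0 x))\<^sup>2)"
  obtains w where "weighted_chain a b (\<lambda>x. r x / Y x) l w"
    and "\<And>x. x \<in> {a..b} \<Longrightarrow>
      r x / Y x * (cmod (w 0 x))\<^sup>2 = r x * Y x powr (\<alpha> - 2 * real l) * (cmod (g 0 x))\<^sup>2"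
    and "T summable_on {1..}"
    and "A_const l \<alpha> * integral {a..b} (\<lambda>x. r x * Y x powr (\<alpha> - 2 * real l) * (cmod (g 0 x))\<^sup>2)
       + B_const l \<alpha> * infsum T {1..}
       + (\<Sum>j=2..l. \<bar>c_coeff (2 * j) l \<alpha>\<bar> * integral {a..b} (\<lambda>x. r x / Y x * (cmod (w j x))\<^sup>2))
      \<le> integral {a..b} (\<lambda>x. r x * Y x powr \<alpha> * (cmod (g l x))\<^sup>2)"
proof -
  from emden_energy[OF ab g r(1) Y \<eta>, of \<alpha>]
  obtain w where w: "weighted_chain a b (\<lambda>x. r x / Y x) l w"
    and w0: "\<And>x. x \<in> {a..b} \<Longrightarrow>
      r x / Y x * (cmod (w 0 x))\<^sup>2 = r x * Y x powr (\<alpha> - 2 * real l) * (cmod (g 0 x))\<^sup>2"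
    and E: "integral {a..b} (\<lambda>x. r x * Y x powr \<alpha> * (cmod (g l x))\<^sup>2) =
      (\<Sum>n\<le>l. coeff (energy_poly l \<alpha>) n * integral {a..b} (\<lambda>x. r x / Y x * (cmod (w n x))\<^sup>2))"
    by blast
  let ?I = "\<lambda>n. integral {a..b} (\<lambda>x. r x / Y x * (cmod (w n x))\<^sup>2)"
  have Yc: "continuous_on {a..b} Y"
    using Y(2) by (rule DERIV_continuous_on)
  have R: "continuous_on {a..b} (\<lambda>x. r x / Y x)"
    using Y(1) by (intro continuous_intros r Yc) force
  have T: "T k = integral {a..b} (\<lambda>x. r x / Y x * (\<Prod>p=1..k. (norm_log p (z x))\<^sup>2) * (cmod (w 0 x))\<^sup>2)" for k
    unfolding T_def
  proof (rule integral_cong)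
    fix x assume "x \<in> {a..b}"
    from arg_cong[OF w0[OF this], of "\<lambda>t. t * (\<Prod>p=1..k. (norm_log p (z x))\<^sup>2)"]
    show "r x * Y x powr (\<alpha> - 2 * real l) * (\<Prod>p=1..k. (norm_log p (z x))\<^sup>2) * (cmod (g 0 x))\<^sup>2 =
        r x / Y x * (\<Prod>p=1..k. (norm_log p (z x))\<^sup>2) * (cmod (w 0 x))\<^sup>2"
      by (simp add: mult_ac)
  qed
  \<comment> \<open>For a non-integrable function \<open>integral\<close> is 0 by convention, so
    both cases give nonnegativity.\<close>
  have "0 \<le> T k" for k
  proof (cases "(\<lambda>x. r x * Y x powr (\<alpha> - 2 * real l) * (\<Prod>p=1..k. (norm_log p (z x))\<^sup>2) * (cmod (g 0 x))\<^sup>2)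
      integrable_on {a..b}")
    case True
    then show ?thesis unfolding T_def
      using less_imp_le[OF r(2)] by (intro integral_nonneg) (auto intro!: mult_nonneg_nonneg prod_nonneg)
  qed (simp add: T_def not_integrable_integral)
  moreover have "(\<Sum>k=1..N. T k) \<le> 4 * ?I 1" for N
    unfolding T using r Y(1) by (intro log_hardy_finite[OF ab w l R _ \<epsilon> z]) auto
  ultimately have sum: "T summable_on {1..}" and inf: "infsum T {1..} \<le> 4 * ?I 1"
    using nonneg_bounded_partial_sums_infsum by blast+
  have "(\<Sum>n\<le>l. coeff (energy_poly l \<alpha>) n * ?I n) =
      coeff (energy_poly l \<alpha>) 0 * ?I 0 + (coeff (energy_poly l \<alpha>) 1 * ?I 1 +
      (\<Sum>n=2..l. coeff (energy_poly l \<alpha>) n * ?I n))"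
  proof -
    have "{..l} = insert 0 (insert 1 {2..l})" using l by auto
    then show ?thesis by simp
  qed
  also have "\<dots> = A_const l \<alpha> * ?I 0 + (B_const l \<alpha> * (4 * ?I 1) +
      (\<Sum>n=2..l. \<bar>c_coeff (2 * n) l \<alpha>\<bar> * ?I n))"
    by (simp only: energy_poly_coeff_0 energy_poly_coeff_1[OF l] abs_c_coeff mult.assoc mult.left_commute[of 4])
  finally have E': "integral {a..b} (\<lambda>x. r x * Y x powr \<alpha> * (cmod (g l x))\<^sup>2) = \<dots>"
    using E by simp
  have "0 \<le> B_const l \<alpha>"
    using energy_poly_coeff_1[OF l] energy_poly_nonneg[of l \<alpha> 1] by simp
  \<comment> \<open>The constant 4 of the finite Hardy inequality is matched by the coefficient 4 B
    of the energy of index 1.\<close>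
  then have "B_const l \<alpha> * infsum T {1..} \<le> B_const l \<alpha> * (4 * ?I 1)"
    using inf by (rule mult_left_mono[rotated])
  moreover have "?I 0 = integral {a..b} (\<lambda>x. r x * Y x powr (\<alpha> - 2 * real l) * (cmod (g 0 x))\<^sup>2)"
    using w0 by (rule integral_cong)
  ultimately show ?thesis
    using E' by (intro that[OF w w0 sum]) auto
qed

section \<open>The two-level inequality on a compact interval\<close>

lemma weighted_chain_mono: "weighted_chain a b r l w \<Longrightarrow> j \<le> l \<Longrightarrow> weighted_chain a b r j w"
  by (simp add: weighted_chain_def)

text \<open>The energy of D^j w left by the first level has weight 1/x. The second level treats it
  with exponent 0, order j and Y = 1/L_1(z) = 1 - ln z, so that Y^(-2j) supplies the factor
  L_1^(2j).\<close>

lemma log_hardy_rellich: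
  fixes \<alpha> :: real
  assumes ab: "a \<le> b" "0 < a" and g: "weighted_chain a b (\<lambda>_. 1) l g" and l: "1 \<le> l"
    and \<epsilon>: "\<epsilon>\<^sup>2 = (1::real)"
    and z: "\<And>x. x \<in> {a..b} \<Longrightarrow> 0 < z x \<and> z x \<le> 1"
      "\<And>x. x \<in> {a..b} \<Longrightarrow> (z has_real_derivative - \<epsilon> * (1 / x) * z x) (at x within {a..b})"
  defines "T \<equiv> \<lambda>k. integral {a..b} (\<lambda>x. x powr (\<alpha> - 2 * real l) *
      (\<Prod>p=1..k. (norm_log p (z x))\<^sup>2) * (cmod (g 0 x))\<^sup>2)"
    and "U \<equiv> \<lambda>j k. integral {a..b} (\<lambda>x. x powr (\<alpha> - 2 * real l) * norm_log 1 (z x) ^ (2 * j) *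
      (\<Prod>p=1..k. (norm_log (p + 1) (z x))\<^sup>2) * (cmod (g 0 x))\<^sup>2)"
  shows "T summable_on {1..} \<and> (\<forall>j\<in>{2..l}. U j summable_on {1..}) \<and>
    integral {a..b} (\<lambda>x. x powr \<alpha> * (cmod (g l x))\<^sup>2) \<ge>
      A_const l \<alpha> * integral {a..b} (\<lambda>x. x powr (\<alpha> - 2 * real l) * (cmod (g 0 x))\<^sup>2)
      + B_const l \<alpha> * infsum T {1..}
      + (\<Sum>j=2..l. \<bar>c_coeff (2 * j) l \<alpha>\<bar> * A_const j 0 *
          integral {a..b} (\<lambda>x. x powr (\<alpha> - 2 * real l) * norm_log 1 (z x) ^ (2 * j) * (cmod (g 0 x))\<^sup>2))
      + (\<Sum>j=2..l. \<bar>c_coeff (2 * j) l \<alpha>\<bar> * B_const j 0 * infsum (U j) {1..})"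
proof -
  have pos: "0 < x" if "x \<in> {a..b}" for x using that ab by simp
  have id: "((\<lambda>x. x) has_real_derivative 1 * 1) (at x within {a..b})" for x by simp
  from hardy_rellich_remainder[OF ab(1) g l continuous_on_const zero_less_one pos id one_power2 \<epsilon> z, of \<alpha>]
  obtain w where w: "weighted_chain a b (\<lambda>x. 1 / x) l w"
    and w0: "\<And>x. x \<in> {a..b} \<Longrightarrow> 1 / x * (cmod (w 0 x))\<^sup>2 = x powr (\<alpha> - 2 * real l) * (cmod (g 0 x))\<^sup>2"
    and T: "T summable_on {1..}"
    and E: "A_const l \<alpha> * integral {a..b} (\<lambda>x. x powr (\<alpha> - 2 * real l) * (cmod (g 0 x))\<^sup>2)
       + B_const l \<alpha> * infsum T {1..}
       + (\<Sum>j=2..l. \<bar>c_coeff (2 * j) l \<alpha>\<bar> * integral {a..b} (\<lambda>x. 1 / x * (cmod (w j x))\<^sup>2))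
      \<le> integral {a..b} (\<lambda>x. x powr \<alpha> * (cmod (g l x))\<^sup>2)"
    unfolding T_def mult_1_left by blast
  define y where "y x = norm_log 1 (z x)" for x
  define Y where "Y x = inverse (y x)" for x
  have y: "0 < y x \<and> y x \<le> 1" if "x \<in> {a..b}" for x
    unfolding y_def using norm_log_in_unit z(1)[OF that] by blast
  have yd: "(y has_real_derivative - \<epsilon> * (1 / x) * y x * y x) (at x within {a..b})" if "x \<in> {a..b}" for x
    using has_real_derivative_norm_log[OF z(2), of x 1] z(1)[OF that] that
    by (simp add: y_def[abs_def])
  have Y: "0 < Y x" if "x \<in> {a..b}" for x using y[OF that] by (simp add: Y_def)
  have Yd: "(Y has_real_derivative \<epsilon> * (1 / x)) (at x within {a..b})" if "x \<in> {a..b}" for x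
    using DERIV_inverse_fun[OF yd[OF that]] y[OF that]
    by (simp add: Y_def[abs_def] field_simps)
  \<comment> \<open>Because y^2 = y/Y, the function \<open>y\<close> satisfies the equation required
    of \<open>z\<close> for the weight (1/x)/Y.\<close>
  have yd': "(y has_real_derivative - \<epsilon> * (1 / x / Y x) * y x) (at x within {a..b})" if "x \<in> {a..b}" for x
    using yd[OF that] by (simp add: Y_def field_simps)
  have rc: "continuous_on {a..b} (\<lambda>x. 1 / x)" using pos by (intro continuous_intros) force
  have rpos: "0 < 1 / x" if "x \<in> {a..b}" for x using pos[OF that] by simp
  have level2: "U j summable_on {1..} \<and> A_const j 0 *
        integral {a..b} (\<lambda>x. x powr (\<alpha> - 2 * real l) * norm_log 1 (z x) ^ (2 * j) * (cmod (g 0 x))\<^sup>2)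
      + B_const j 0 * infsum (U j) {1..} \<le> integral {a..b} (\<lambda>x. 1 / x * (cmod (w j x))\<^sup>2)"
    if j: "j \<in> {2..l}" for j
  proof -
    \<comment> \<open>\<open>Z\<close> stands for the product of logarithms, or for 1.\<close>
    have Yj: "1 / x * Y x powr (0 - 2 * real j) * Z * (cmod (w 0 x))\<^sup>2 =
        x powr (\<alpha> - 2 * real l) * norm_log 1 (z x) ^ (2 * j) * Z * (cmod (g 0 x))\<^sup>2"
      if "x \<in> {a..b}" for x Z
    proof -
      have "Y x powr (0 - 2 * real j) = y x powr real (2 * j)"
        using y[OF that] by (simp add: Y_def powr_minus inverse_powr)
      also have "\<dots> = norm_log 1 (z x) ^ (2 * j)"
        using y[OF that] by (subst powr_realpow) (simp_all add: y_def)
      finally have "1 / x * Y x powr (0 - 2 * real j) * Z * (cmod (w 0 x))\<^sup>2 =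
          (1 / x * (cmod (w 0 x))\<^sup>2) * (norm_log 1 (z x) ^ (2 * j) * Z)" by simp
      then show ?thesis unfolding w0[OF that] by simp
    qed
    have U: "integral {a..b} (\<lambda>x. 1 / x * Y x powr (0 - 2 * real j) * (\<Prod>p=1..k. (norm_log p (y x))\<^sup>2) *
        (cmod (w 0 x))\<^sup>2) = U j k" for k
      unfolding U_def by (rule integral_cong) (simp only: Yj, simp only: y_def norm_log_comp)
    have V: "integral {a..b} (\<lambda>x. 1 / x * Y x powr (0 - 2 * real j) * (cmod (w 0 x))\<^sup>2) =
        integral {a..b} (\<lambda>x. x powr (\<alpha> - 2 * real l) * norm_log 1 (z x) ^ (2 * j) * (cmod (g 0 x))\<^sup>2)"
      using Yj[where Z = 1] by (intro integral_cong) simp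
    \<comment> \<open>Positivity of \<open>Y\<close> matters here: \<open>0 powr 0\<close> is 0, not
      1.\<close>
    have W: "integral {a..b} (\<lambda>x. 1 / x * Y x powr 0 * (cmod (w j x))\<^sup>2) =
        integral {a..b} (\<lambda>x. 1 / x * (cmod (w j x))\<^sup>2)"
      using Y by (intro integral_cong) force
    have wj: "weighted_chain a b (\<lambda>x. 1 / x) j w" and "1 \<le> j"
      using weighted_chain_mono[OF w] j by auto
    \<comment> \<open>Here both signs are \<epsilon>, since Y has derivative \<epsilon>/x.\<close>
    from hardy_rellich_remainder[OF ab(1) this rc rpos Y Yd \<epsilon> \<epsilon> y yd', of 0]
    obtain u where u: "U j summable_on {1..}" "A_const j 0 *
        integral {a..b} (\<lambda>x. x powr (\<alpha> - 2 * real l) * norm_log 1 (z x) ^ (2 * j) * (cmod (g 0 x))\<^sup>2)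
      + B_const j 0 * infsum (U j) {1..}
      + (\<Sum>i=2..j. \<bar>c_coeff (2 * i) j 0\<bar> * integral {a..b} (\<lambda>x. 1 / x / Y x * (cmod (u i x))\<^sup>2))
      \<le> integral {a..b} (\<lambda>x. 1 / x * (cmod (w j x))\<^sup>2)"
      unfolding U V W by blast
    \<comment> \<open>What the second level leaves over is nonnegative and is discarded.\<close>
    have "0 \<le> (\<Sum>i=2..j. \<bar>c_coeff (2 * i) j 0\<bar> * integral {a..b} (\<lambda>x. 1 / x / Y x * (cmod (u i x))\<^sup>2))"
    proof (intro sum_nonneg mult_nonneg_nonneg abs_ge_zero)
      fix i
      show "0 \<le> integral {a..b} (\<lambda>x. 1 / x / Y x * (cmod (u i x))\<^sup>2)"
        using less_imp_le[OF pos] less_imp_le[OF Y]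
        by (cases "(\<lambda>x. 1 / x / Y x * (cmod (u i x))\<^sup>2) integrable_on {a..b}")
          (auto intro!: integral_nonneg simp: not_integrable_integral)
    qed
    with u show ?thesis by linarith
  qed
  have "(\<Sum>j=2..l. \<bar>c_coeff (2 * j) l \<alpha>\<bar> * (A_const j 0 *
          integral {a..b} (\<lambda>x. x powr (\<alpha> - 2 * real l) * norm_log 1 (z x) ^ (2 * j) * (cmod (g 0 x))\<^sup>2)
        + B_const j 0 * infsum (U j) {1..}))
      \<le> (\<Sum>j=2..l. \<bar>c_coeff (2 * j) l \<alpha>\<bar> * integral {a..b} (\<lambda>x. 1 / x * (cmod (w j x))\<^sup>2))"
    using level2 by (intro sum_mono mult_left_mono) auto
  then show ?thesis
    using E T level2 by (simp add: distrib_left sum.distrib mult.assoc)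
qed

section \<open>From compact intervals to test functions on open intervals\<close>

lemma set_lborel_integral_eq_integral:
  fixes h :: "real \<Rightarrow> real"
  assumes "continuous_on {a..b} h" "{a..b} \<subseteq> S" "\<And>x. x \<in> S - {a..b} \<Longrightarrow> h x = 0"
  shows "(LBINT x:S. h x) = integral {a..b} h"
proof -
  have "(LBINT x:S. h x) = (LBINT x:{a..b}. h x)"
    unfolding set_lebesgue_integral_def
    using assms(2,3) by (intro Bochner_Integration.integral_cong) (auto simp: indicator_def)
  also have "\<dots> = integral {a..b} h"
    using assms(1) by (intro set_borel_integral_eq_integral borel_integrable_atLeastAtMost')
  finally show ?thesis .
qed

lemma nth_deriv_Suc: "nth_deriv (Suc k) f x = vector_derivative (nth_deriv k f) (at x)"
  by (simp add: nth_deriv_def)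

lemma nth_deriv_has_vector_derivative:
  assumes "f \<in> test_functions S"
  shows "(nth_deriv k f has_vector_derivative nth_deriv (Suc k) f x) (at x)"
  unfolding nth_deriv_Suc using assms by (simp add: test_functions_def flip: vector_derivative_works)

text \<open>The complement of the support is open, so a function vanishing on it has zero derivative
  there, at every order.\<close>

lemma nth_deriv_eq_0:
  assumes "x \<notin> closure {x. f x \<noteq> 0}"
  shows "nth_deriv k f x = 0"
  using assms
proof (induction k arbitrary: x)
  case 0
  then show ?case using closure_subset[of "{x. f x \<noteq> 0}"] by (auto simp: nth_deriv_def)
next
  case (Suc k)
  have "(nth_deriv k f has_vector_derivative 0) (at x)"
  proof (rule has_vector_derivative_transform_within_open)
    show "((\<lambda>_. 0) has_vector_derivative 0) (at x)" by simp
    show "open (- closure {x. f x \<noteq> 0})" "x \<in> - closure {x. f x \<noteq> 0}"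
      using Suc.prems by auto
    show "0 = nth_deriv k f y" if "y \<in> - closure {x. f x \<noteq> 0}" for y
      using Suc.IH[of y] that by simp
  qed
  then show ?case
    by (simp add: nth_deriv_Suc vector_derivative_at)
qed

text \<open>Openness leaves room to enlarge [min K, max K] on both sides. The new endpoints lie
  outside K, which supplies the zero boundary values of a chain.\<close>

lemma compact_subset_interior_interval:
  fixes K S :: "real set"
  assumes "compact K" "K \<subseteq> S" "open S" "is_interval S" "S \<noteq> {}"
  obtains a b where "a \<le> b" "{a..b} \<subseteq> S" "K \<subseteq> {a<..<b}"
proof (cases "K = {}")
  case True
  with assms(5) that show ?thesis by (metis atLeastAtMost_singleton empty_subsetI ex_in_conv insert_subset order_refl)
next
  case False
  obtain c d where c: "c \<in> K" "\<And>x. x \<in> K \<Longrightarrow> c \<le> x" and d: "d \<in> K" "\<And>x. x \<in> K \<Longrightarrow> x \<le> d"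
    using compact_attains_inf[OF assms(1) False] compact_attains_sup[OF assms(1) False] by blast
  obtain e e' where e: "0 < e" "cball c e \<subseteq> S" "0 < e'" "cball d e' \<subseteq> S"
    using assms c d by (meson open_contains_cball subsetD)
  have S: "c - e \<in> S" "d + e' \<in> S" using e by (auto simp: cball_def dist_real_def subset_iff)
  show ?thesis
  proof
    show "c - e \<le> d + e'" using c(2)[OF d(1)] e by simp
    show "{c - e..d + e'} \<subseteq> S" using mem_is_interval_1_I[OF assms(4) S] by auto
    show "K \<subseteq> {c - e<..<d + e'}"
    proof
      fix x assume "x \<in> K"
      then show "x \<in> {c - e<..<d + e'}" using c(2)[of x] d(2)[of x] e(1,3) by simp
    qed
  qed
qed

text \<open>Common form of both halves of the theorem, which differ only in \<open>S\<close>,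
  \<open>z\<close> and the sign \<epsilon>.\<close>

lemma log_hardy_rellich_test_functions:
  fixes \<alpha> :: real
  assumes S: "open S" "is_interval S" "S \<subseteq> {0<..}" "S \<noteq> {}" and f: "f \<in> test_functions S"
    and l: "1 \<le> l" "l \<le> m" and \<epsilon>: "\<epsilon>\<^sup>2 = (1::real)"
    and z: "\<And>x. x \<in> S \<Longrightarrow> 0 < z x \<and> z x \<le> 1"
      "\<And>x. x \<in> S \<Longrightarrow> (z has_real_derivative - \<epsilon> * (1 / x) * z x) (at x)"
  shows "(\<lambda>k. LBINT x:S. x powr (\<alpha> - 2 * real l) * (\<Prod>p=1..k. (norm_log p (z x))\<^sup>2) *
           (cmod (nth_deriv (m - l) f x))\<^sup>2) summable_on {1..} \<and>
    (\<forall>j\<in>{2..l}. (\<lambda>k. LBINT x:S. x powr (\<alpha> - 2 * real l) * norm_log 1 (z x) ^ (2 * j) *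
       (\<Prod>p=1..k. (norm_log (p + 1) (z x))\<^sup>2) * (cmod (nth_deriv (m - l) f x))\<^sup>2) summable_on {1..}) \<and>
    (LBINT x:S. x powr \<alpha> * (cmod (nth_deriv m f x))\<^sup>2) \<ge>
      A_const l \<alpha> * (LBINT x:S. x powr (\<alpha> - 2 * real l) * (cmod (nth_deriv (m - l) f x))\<^sup>2)
      + B_const l \<alpha> * (\<Sum>\<^sub>\<infinity>k\<in>{1..}. LBINT x:S. x powr (\<alpha> - 2 * real l) *
          (\<Prod>p=1..k. (norm_log p (z x))\<^sup>2) * (cmod (nth_deriv (m - l) f x))\<^sup>2)
      + (\<Sum>j=2..l. \<bar>c_coeff (2 * j) l \<alpha>\<bar> * A_const j 0 *
          (LBINT x:S. x powr (\<alpha> - 2 * real l) * norm_log 1 (z x) ^ (2 * j) *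
            (cmod (nth_deriv (m - l) f x))\<^sup>2))
      + (\<Sum>j=2..l. \<bar>c_coeff (2 * j) l \<alpha>\<bar> * B_const j 0 * (\<Sum>\<^sub>\<infinity>k\<in>{1..}.
          LBINT x:S. x powr (\<alpha> - 2 * real l) * norm_log 1 (z x) ^ (2 * j) *
            (\<Prod>p=1..k. (norm_log (p + 1) (z x))\<^sup>2) * (cmod (nth_deriv (m - l) f x))\<^sup>2))"
proof -
  let ?K = "closure {x. f x \<noteq> 0}"
  have "compact ?K" "?K \<subseteq> S" using f by (auto simp: test_functions_def)
  then obtain a b where ab: "a \<le> b" "{a..b} \<subseteq> S" and K: "?K \<subseteq> {a<..<b}"
    using compact_subset_interior_interval S by metis
  have pos: "0 < x" if "x \<in> {a..b}" for x using that ab S by auto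
  have zero: "nth_deriv k f x = 0" if "x \<notin> {a<..<b}" for k x
    using nth_deriv_eq_0 K that by blast
  have cont: "continuous_on {a..b} (nth_deriv k f)" for k
    using nth_deriv_has_vector_derivative[OF f]
    by (intro continuous_at_imp_continuous_on) (auto intro: has_vector_derivative_continuous)
  \<comment> \<open>The chain starts at order m - l; as l <= m, its last member has order m.\<close>
  have chain: "weighted_chain a b (\<lambda>_. 1) l (\<lambda>i. nth_deriv (m - l + i) f)"
    unfolding weighted_chain_def
    using nth_deriv_has_vector_derivative[OF f] cont zero
    by (auto intro: has_vector_derivative_at_within)
  have zd: "(z has_real_derivative - \<epsilon> * (1 / x) * z x) (at x within {a..b})" if "x \<in> {a..b}" for x
    by (rule has_field_derivative_at_within[OF z(2)]) (use ab(2) that in auto)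
  have z01: "0 < z x \<and> z x \<le> 1" if "x \<in> {a..b}" for x using z(1) ab(2) that by auto
  have logc: "continuous_on {a..b} (\<lambda>x. norm_log p (z x))" for p
    by (rule DERIV_continuous_on, rule has_real_derivative_norm_log[OF zd]) (use z01 in auto)
  have powrc: "continuous_on {a..b} (\<lambda>x. x powr e)" for e :: real
    using pos by (intro continuous_intros) force
  \<comment> \<open>Every integral of the statement has this form, with a weight continuous on the
    compact interval.\<close>
  have conv: "(LBINT x:S. h x * (cmod (nth_deriv k f x))\<^sup>2) = integral {a..b} (\<lambda>x. h x * (cmod (nth_deriv k f x))\<^sup>2)"
    if "continuous_on {a..b} h" for h k
    using that zero ab(2) by (intro set_lborel_integral_eq_integral continuous_intros cont) auto
  show ?thesis
    using log_hardy_rellich[OF ab(1) _ chain l(1) \<epsilon> z01 zd, of \<alpha>] pos[of a] ab(1) l(2)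
    by (simp add: conv powrc logc continuous_on_mult continuous_on_prod continuous_on_power)
qed

text \<open>Summability is asserted along with the inequality because \<open>infsum\<close> is 0 by
  convention for a family that is not summable.\<close>

theorem corollary3p2:
  fixes l m :: nat and \<alpha> \<rho> \<tau> :: real
  assumes "1 \<le> l" and "l \<le> m" and "0 < \<rho>" and "0 < \<tau>"
  shows "(\<tau> \<le> \<rho> \<longrightarrow> (\<forall>f\<in>test_functions {\<rho><..}.
           (\<lambda>k. (LBINT x:{\<rho><..}. x powr (\<alpha> - 2 * real l) * (\<Prod>p=1..k. (norm_log p (\<tau> / x))\<^sup>2) * (cmod (nth_deriv (m - l) f x))\<^sup>2)) summable_on {1..} \<and>
           (\<forall>j\<in>{2..l}.
              (\<lambda>k. (LBINT x:{\<rho><..}. x powr (\<alpha> - 2 * real l) * (norm_log 1 (\<tau> / x)) ^ (2 * j) *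
                   (\<Prod>p=1..k. (norm_log (p + 1) (\<tau> / x))\<^sup>2) * (cmod (nth_deriv (m - l) f x))\<^sup>2)) summable_on {1..}) \<and>
           (LBINT x:{\<rho><..}. x powr \<alpha> * (cmod (nth_deriv m f x))\<^sup>2) \<ge>
             A_const l \<alpha> *
                 (LBINT x:{\<rho><..}. x powr (\<alpha> - 2 * real l) * (cmod (nth_deriv (m - l) f x))\<^sup>2)
             + B_const l \<alpha> * (\<Sum>\<^sub>\<infinity>k\<in>{1..}.
                 (LBINT x:{\<rho><..}. x powr (\<alpha> - 2 * real l) * (\<Prod>p=1..k. (norm_log p (\<tau> / x))\<^sup>2) * (cmod (nth_deriv (m - l) f x))\<^sup>2))
             + (\<Sum>j=2..l. \<bar>c_coeff (2 * j) l \<alpha>\<bar> * A_const j 0 *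
                 (LBINT x:{\<rho><..}. x powr (\<alpha> - 2 * real l) * (norm_log 1 (\<tau> / x)) ^ (2 * j) * (cmod (nth_deriv (m - l) f x))\<^sup>2))
             + (\<Sum>j=2..l. \<bar>c_coeff (2 * j) l \<alpha>\<bar> * B_const j 0 * (\<Sum>\<^sub>\<infinity>k\<in>{1..}.
                 (LBINT x:{\<rho><..}. x powr (\<alpha> - 2 * real l) * (norm_log 1 (\<tau> / x)) ^ (2 * j) *
                   (\<Prod>p=1..k. (norm_log (p + 1) (\<tau> / x))\<^sup>2) * (cmod (nth_deriv (m - l) f x))\<^sup>2)))))
         \<and>
         (\<rho> \<le> \<tau> \<longrightarrow> (\<forall>f\<in>test_functions {0<..<\<rho>}.
           (\<lambda>k. (LBINT x:{0<..<\<rho>}. x powr (\<alpha> - 2 * real l) * (\<Prod>p=1..k. (norm_log p (x / \<tau>))\<^sup>2) * (cmod (nth_deriv (m - l) f x))\<^sup>2)) summable_on {1..} \<and>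
           (\<forall>j\<in>{2..l}.
              (\<lambda>k. (LBINT x:{0<..<\<rho>}. x powr (\<alpha> - 2 * real l) * (norm_log 1 (x / \<tau>)) ^ (2 * j) *
                   (\<Prod>p=1..k. (norm_log (p + 1) (x / \<tau>))\<^sup>2) * (cmod (nth_deriv (m - l) f x))\<^sup>2)) summable_on {1..}) \<and>
           (LBINT x:{0<..<\<rho>}. x powr \<alpha> * (cmod (nth_deriv m f x))\<^sup>2) \<ge>
             A_const l \<alpha> *
                 (LBINT x:{0<..<\<rho>}. x powr (\<alpha> - 2 * real l) * (cmod (nth_deriv (m - l) f x))\<^sup>2)
             + B_const l \<alpha> * (\<Sum>\<^sub>\<infinity>k\<in>{1..}.
                 (LBINT x:{0<..<\<rho>}. x powr (\<alpha> - 2 * real l) * (\<Prod>p=1..k. (norm_log p (x / \<tau>))\<^sup>2) * (cmod (nth_deriv (m - l) f x))\<^sup>2))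
             + (\<Sum>j=2..l. \<bar>c_coeff (2 * j) l \<alpha>\<bar> * A_const j 0 *
                 (LBINT x:{0<..<\<rho>}. x powr (\<alpha> - 2 * real l) * (norm_log 1 (x / \<tau>)) ^ (2 * j) * (cmod (nth_deriv (m - l) f x))\<^sup>2))
             + (\<Sum>j=2..l. \<bar>c_coeff (2 * j) l \<alpha>\<bar> * B_const j 0 * (\<Sum>\<^sub>\<infinity>k\<in>{1..}.
                 (LBINT x:{0<..<\<rho>}. x powr (\<alpha> - 2 * real l) * (norm_log 1 (x / \<tau>)) ^ (2 * j) *
                   (\<Prod>p=1..k. (norm_log (p + 1) (x / \<tau>))\<^sup>2) * (cmod (nth_deriv (m - l) f x))\<^sup>2)))))"
proof ((rule conjI; intro impI ballI), goal_cases)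
  case (1 f)
  \<comment> \<open>Here z = \<tau>/x decreases, so \<epsilon> = 1.\<close>
  have "((\<lambda>x. \<tau> / x) has_real_derivative - 1 * (1 / x) * (\<tau> / x)) (at x)" if "x \<in> {\<rho><..}" for x
    using that assms(3) by (auto intro!: derivative_eq_intros simp: field_simps)
  moreover have "0 < \<tau> / x \<and> \<tau> / x \<le> 1" if "x \<in> {\<rho><..}" for x
    using that assms(3,4) 1(1) by simp
  ultimately show ?case
    using assms(1-3)
    by (intro log_hardy_rellich_test_functions[OF _ _ _ _ 1(2), of _ _ 1]) (auto simp: is_interval_1)
next
  case (2 f)
  \<comment> \<open>Here z = x/\<tau> increases, so \<epsilon> = -1.\<close>
  have "((\<lambda>x. x / \<tau>) has_real_derivative - (- 1) * (1 / x) * (x / \<tau>)) (at x)" if "x \<in> {0<..<\<rho>}" for x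
    using that assms(4) by (auto intro!: derivative_eq_intros)
  moreover have "0 < x / \<tau> \<and> x / \<tau> \<le> 1" if "x \<in> {0<..<\<rho>}" for x
    using that assms(4) 2(1) by simp
  ultimately show ?case
    using assms(1-3)
    by (intro log_hardy_rellich_test_functions[OF _ _ _ _ 2(2), of _ _ "- 1"]) (auto simp: is_interval_1)
qed

end
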